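(* Let $(W,S)$ be a Coxeter system (with $W$ not necessarily finite), and let $[u,v]_L$ and $[u',v']_L$ be elements of $\mathrm{Int}(W)$. Then $[u,v]_L$ is descent-preserving isomorphic to $[u',v']_L$ if and only if $vu^{-1}=v'u'^{-1}$ and $\mathrm{Des}_L(x)=\mathrm{Des}_L(xu^{-1}u')$ for all $x\in[u,v]_L$.
   Context: For a Coxeter system $(W,S)$, $\ell$ is the length function with respect to $S$, and $\mathrm{Des}_L(w)=\{s\in S\mid \ell(sw)<\ell(w)\}$. The left weak Bruhat order is given by $u\leq_L v$ iff $\ell(v)=\ell(u)+\ell(vu^{-1})$. For $u\leq_L v$, $[u,v]_L=\{w\in W\mid u\leq_L w\leq_L v\}$, and $\mathrm{Int}(W)=\{[u,v]_L\mid u,v\in W,\ u\leq_L v\}$. Two intervals $I_1,I_2\in\mathrm{Int}(W)$ are descent-preserving isomorphic if there is a descent-preserving isomorphism between them, i.e. a poset isomorphism $f:(I_1,\leq_L)\to(I_2,\leq_L)$ with $\mathrm{Des}_L(w)=\mathrm{Des}_L(f(w))$ for all $w\in I_1$. *)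

theory Defs
  imports "HOL-Algebra.Generated_Groups" "HOL-Library.Extended_Nat"
begin

text \<open>Group presentations. A letter \<open>(s, True)\<close> stands for the generator \<open>s\<close> and
  \<open>(s, False)\<close> for its formal inverse. \<open>presented_eq S R v w\<close> says that \<open>v\<close> and \<open>w\<close> name the same
  element of the group presented by generators \<open>S\<close> and relators \<open>R\<close>.\<close>

inductive presented_eq ::
    "'a set \<Rightarrow> ('a \<times> bool) list set \<Rightarrow> ('a \<times> bool) list \<Rightarrow> ('a \<times> bool) list \<Rightarrow> bool"
  for S R where
  refl: "w \<in> lists (S \<times> UNIV) \<Longrightarrow> presented_eq S R w w"
| sym: "presented_eq S R v w \<Longrightarrow> presented_eq S R w v"
| trans: "presented_eq S R u v \<Longrightarrow> presented_eq S R v w \<Longrightarrow> presented_eq S R u w"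
| cancel: "p \<in> lists (S \<times> UNIV) \<Longrightarrow> q \<in> lists (S \<times> UNIV) \<Longrightarrow> s \<in> S \<Longrightarrow>
    presented_eq S R (p @ [(s, b), (s, \<not> b)] @ q) (p @ q)"
| relator: "p \<in> lists (S \<times> UNIV) \<Longrightarrow> q \<in> lists (S \<times> UNIV) \<Longrightarrow> r \<in> R \<Longrightarrow>
    presented_eq S R (p @ r @ q) (p @ q)"

definition eval_word :: "('a, 'b) monoid_scheme \<Rightarrow> ('a \<times> bool) list \<Rightarrow> 'a" where
  "eval_word G w =
    foldr (\<lambda>(s, b) g. (if b then s else inv\<^bsub>G\<^esub> s) \<otimes>\<^bsub>G\<^esub> g) w \<one>\<^bsub>G\<^esub>"

text \<open>The canonical map from the group presented by \<open>\<langle>S | R\<rangle>\<close> to \<open>G\<close> is well defined, injective and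
  surjective.\<close>

definition has_presentation ::
    "('a, 'b) monoid_scheme \<Rightarrow> 'a set \<Rightarrow> ('a \<times> bool) list set \<Rightarrow> bool" where
  "has_presentation G S R \<longleftrightarrow>
    S \<subseteq> carrier G \<and> R \<subseteq> lists (S \<times> UNIV) \<and> generate G S = carrier G \<and>
    (\<forall>v \<in> lists (S \<times> UNIV). \<forall>w \<in> lists (S \<times> UNIV).
      eval_word G v = eval_word G w \<longleftrightarrow> presented_eq S R v w)"

definition coxeter_matrix :: "'a set \<Rightarrow> ('a \<Rightarrow> 'a \<Rightarrow> enat) \<Rightarrow> bool" where
  "coxeter_matrix S m \<longleftrightarrow>
    (\<forall>s\<in>S. m s s = 1) \<and>
    (\<forall>s\<in>S. \<forall>t\<in>S. s \<noteq> t \<longrightarrow> m s t = m t s \<and> m s t \<ge> 2)"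

text \<open>The relators \<open>(st)\<^sup>m\<close> with \<open>m = m s t\<close>; there is none for a pair with \<open>m s t = \<infinity>\<close>.\<close>

definition coxeter_relators :: "'a set \<Rightarrow> ('a \<Rightarrow> 'a \<Rightarrow> enat) \<Rightarrow> ('a \<times> bool) list set" where
  "coxeter_relators S m =
    {concat (replicate n [(s, True), (t, True)]) | s t n. s \<in> S \<and> t \<in> S \<and> m s t = enat n}"

definition coxeter_system :: "('a, 'b) monoid_scheme \<Rightarrow> 'a set \<Rightarrow> bool" where
  "coxeter_system W S \<longleftrightarrow>
    group W \<and> (\<exists>m. coxeter_matrix S m \<and> has_presentation W S (coxeter_relators S m))"

text \<open>Words in \<open>S\<close> without inverses suffice here, since the generators of a Coxeter system are
  involutions.\<close>

definition cox_length :: "('a, 'b) monoid_scheme \<Rightarrow> 'a set \<Rightarrow> 'a \<Rightarrow> nat" where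
  "cox_length W S w =
    (LEAST n. \<exists>ss \<in> lists S. length ss = n \<and> foldr (\<otimes>\<^bsub>W\<^esub>) ss \<one>\<^bsub>W\<^esub> = w)"

definition left_descents :: "('a, 'b) monoid_scheme \<Rightarrow> 'a set \<Rightarrow> 'a \<Rightarrow> 'a set" where
  "left_descents W S w = {s \<in> S. cox_length W S (s \<otimes>\<^bsub>W\<^esub> w) < cox_length W S w}"

definition left_weak_le :: "('a, 'b) monoid_scheme \<Rightarrow> 'a set \<Rightarrow> 'a \<Rightarrow> 'a \<Rightarrow> bool" where
  "left_weak_le W S u v \<longleftrightarrow>
    cox_length W S v = cox_length W S u + cox_length W S (v \<otimes>\<^bsub>W\<^esub> inv\<^bsub>W\<^esub> u)"

definition left_weak_interval :: "('a, 'b) monoid_scheme \<Rightarrow> 'a set \<Rightarrow> 'a \<Rightarrow> 'a \<Rightarrow> 'a set" where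
  "left_weak_interval W S u v =
    {w \<in> carrier W. left_weak_le W S u w \<and> left_weak_le W S w v}"

definition descent_preserving_iso ::
    "('a, 'b) monoid_scheme \<Rightarrow> 'a set \<Rightarrow> 'a set \<Rightarrow> 'a set \<Rightarrow> ('a \<Rightarrow> 'a) \<Rightarrow> bool" where
  "descent_preserving_iso W S I J f \<longleftrightarrow>
    bij_betw f I J \<and>
    (\<forall>x\<in>I. \<forall>y\<in>I. left_weak_le W S x y \<longleftrightarrow> left_weak_le W S (f x) (f y)) \<and>
    (\<forall>x\<in>I. left_descents W S x = left_descents W S (f x))"

definition descent_preserving_isomorphic ::
    "('a, 'b) monoid_scheme \<Rightarrow> 'a set \<Rightarrow> 'a set \<Rightarrow> 'a set \<Rightarrow> bool" where
  "descent_preserving_isomorphic W S I J \<longleftrightarrow> (\<exists>f. descent_preserving_iso W S I J f)"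

end

theory Submission
  imports Defs
begin

text \<open>Let \<open>x < y = sx\<close> be a cover in the left weak order. By the exchange condition, if \<open>t \<noteq> s\<close> is
  a descent of \<open>y\<close> then it is one of \<open>sy = x\<close>; so \<open>s\<close> is the only descent of \<open>y\<close> that \<open>x\<close> lacks, and
  the descent sets of \<open>x\<close> and \<open>y\<close> determine the label \<open>s\<close>. A descent-preserving isomorphism
  \<open>[u,v] \<rightarrow> [u',v']\<close> therefore preserves the labels of covers, and being \<open>u \<mapsto> u'\<close> at the bottom it is
  \<open>x \<mapsto> xu\<^sup>-\<^sup>1u'\<close>. Conversely \<open>[u,v]\<close> is the right translate by \<open>u\<close> of \<open>[1,vu\<^sup>-\<^sup>1]\<close>, with the same order.

  The exchange condition is obtained from the presentation: for each \<open>r\<close>, the parity of the number of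
  times \<open>r\<close> occurs among the reflections attached to a word depends only on the value of the word.\<close>

section \<open>Words in the generators and the length function\<close>

locale coxeter_group = group W for W (structure) +
  fixes S :: "'a set"
  assumes coxeter: "coxeter_system W S"
begin

definition word_prod :: "'a list \<Rightarrow> 'a" where
  "word_prod ss = foldr (\<otimes>) ss \<one>"

lemma word_prod_Nil [simp]: "word_prod [] = \<one>"
  by (simp add: word_prod_def)

lemma word_prod_Cons [simp]: "word_prod (s # ss) = s \<otimes> word_prod ss"
  by (simp add: word_prod_def)

abbreviation len :: "'a \<Rightarrow> nat" where
  "len \<equiv> cox_length W S"

abbreviation Des :: "'a \<Rightarrow> 'a set" where
  "Des \<equiv> left_descents W S"

abbreviation weak_le :: "'a \<Rightarrow> 'a \<Rightarrow> bool" (infix "\<le>\<^sub>L" 50) where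
  "x \<le>\<^sub>L y \<equiv> left_weak_le W S x y"

abbreviation ival :: "'a \<Rightarrow> 'a \<Rightarrow> 'a set" where
  "ival \<equiv> left_weak_interval W S"

lemma S_carrier: "S \<subseteq> carrier W"
  using coxeter by (auto simp: coxeter_system_def has_presentation_def)

lemma S_closed [simp]: "s \<in> S \<Longrightarrow> s \<in> carrier W"
  using S_carrier by blast

lemma generate_S: "generate W S = carrier W"
  using coxeter by (auto simp: coxeter_system_def has_presentation_def)

text \<open>The diagonal entry \<open>m s s = 1\<close> makes the two-letter word \<open>ss\<close>
  itself a relator.\<close>

lemma S_mult_self [simp]:
  assumes "s \<in> S"
  shows "s \<otimes> s = \<one>"
proof -
  obtain m where m: "coxeter_matrix S m" "has_presentation W S (coxeter_relators S m)"
    using coxeter by (auto simp: coxeter_system_def)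
  have "m s s = enat 1"
    using m(1) assms by (simp add: coxeter_matrix_def one_enat_def)
  then have "concat (replicate 1 [(s, True), (s, True)]) \<in> coxeter_relators S m"
    using assms unfolding coxeter_relators_def by blast
  then have "[(s, True), (s, True)] \<in> coxeter_relators S m" by simp
  then have "presented_eq S (coxeter_relators S m) ([] @ [(s, True), (s, True)] @ []) ([] @ [])"
    by (intro presented_eq.relator) auto
  moreover have "[(s, True), (s, True)] \<in> lists (S \<times> UNIV)" "[] \<in> lists (S \<times> UNIV)"
    using assms by auto
  ultimately have "eval_word W [(s, True), (s, True)] = eval_word W []"
    using m(2) unfolding has_presentation_def by simp
  then show ?thesis using assms by (simp add: eval_word_def)
qed

lemma S_inv [simp]: "s \<in> S \<Longrightarrow> inv s = s"
  by (simp add: inv_equality)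

lemma S_cancel [simp]: "s \<in> S \<Longrightarrow> x \<in> carrier W \<Longrightarrow> s \<otimes> (s \<otimes> x) = x"
  by (simp add: m_assoc [symmetric])

lemma inv_cancel [simp]:
  assumes "x \<in> carrier W" "y \<in> carrier W"
  shows "x \<otimes> (inv x \<otimes> y) = y" "inv x \<otimes> (x \<otimes> y) = y"
  using assms by (simp_all flip: m_assoc)

lemma word_prod_closed [simp]: "ss \<in> lists S \<Longrightarrow> word_prod ss \<in> carrier W"
  by (induction ss) auto

lemma word_prod_append:
  "ss \<in> lists S \<Longrightarrow> ts \<in> lists S \<Longrightarrow> word_prod (ss @ ts) = word_prod ss \<otimes> word_prod ts"
  by (induction ss) (auto simp: m_assoc)

lemma eval_word_eq_word_prod:
  "w \<in> lists (S \<times> UNIV) \<Longrightarrow> eval_word W w = word_prod (map fst w)"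
  by (induction w) (auto simp: eval_word_def)

text \<open>Each generator is its own inverse, so the inverses allowed by \<open>generate\<close>
  add no new letters.\<close>

lemma ex_word:
  assumes "x \<in> carrier W"
  shows "\<exists>ss\<in>lists S. word_prod ss = x"
proof -
  have "x \<in> generate W S" using assms generate_S by simp
  then show ?thesis
  proof (induction rule: generate.induct)
    case one
    show ?case by (rule bexI [of _ "[]"]) auto
  next
    case (incl h)
    then show ?case by (intro bexI [of _ "[h]"]) auto
  next
    case (inv h)
    then show ?case by (intro bexI [of _ "[h]"]) auto
  next
    case (eng h1 h2)
    then obtain ss ts where "ss \<in> lists S" "ts \<in> lists S" "word_prod ss = h1" "word_prod ts = h2"
      by blast
    then show ?case by (intro bexI [of _ "ss @ ts"]) (auto simp: word_prod_append)
  qed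
qed

lemma ex_reduced_word:
  assumes "x \<in> carrier W"
  obtains ss where "ss \<in> lists S" "length ss = len x" "word_prod ss = x"
proof -
  have "\<exists>n. \<exists>ss\<in>lists S. length ss = n \<and> word_prod ss = x"
    using ex_word [OF assms] by blast
  from LeastI_ex [OF this] show ?thesis
    using that unfolding cox_length_def word_prod_def by blast
qed

lemma len_word_prod_le: "ss \<in> lists S \<Longrightarrow> len (word_prod ss) \<le> length ss"
  unfolding cox_length_def word_prod_def by (rule Least_le) blast

lemma len_one [simp]: "len \<one> = 0"
  using len_word_prod_le [of "[]"] by simp

lemma len_eq_0_iff: "x \<in> carrier W \<Longrightarrow> len x = 0 \<longleftrightarrow> x = \<one>"
  by (metis ex_reduced_word word_prod_Nil length_0_conv len_one)

lemma len_mult_le: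
  assumes "x \<in> carrier W" "y \<in> carrier W"
  shows "len (x \<otimes> y) \<le> len x + len y"
proof -
  obtain ss where ss: "ss \<in> lists S" "length ss = len x" "word_prod ss = x"
    using ex_reduced_word assms(1) .
  obtain ts where ts: "ts \<in> lists S" "length ts = len y" "word_prod ts = y"
    using ex_reduced_word assms(2) .
  have "ss @ ts \<in> lists S" using ss ts by simp
  from len_word_prod_le [OF this] show ?thesis using ss ts by (simp add: word_prod_append)
qed

lemma len_generator_le: "s \<in> S \<Longrightarrow> len s \<le> 1"
  using len_word_prod_le [of "[s]"] by simp

section \<open>Parities of the reflections attached to a word\<close>

text \<open>The parity of the number of indices \<open>i\<close> with
  \<open>r = s\<^sub>1 \<dots> s\<^sub>i\<^sub>-\<^sub>1 s\<^sub>i s\<^sub>i\<^sub>-\<^sub>1 \<dots> s\<^sub>1\<close>, for the word \<open>s\<^sub>1 \<dots> s\<^sub>k\<close>.\<close>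

fun inversion_parity :: "'a list \<Rightarrow> 'a \<Rightarrow> bool" where
  "inversion_parity [] r = False"
| "inversion_parity (s # ss) r = ((r = s) \<noteq> inversion_parity ss (s \<otimes> r \<otimes> s))"

text \<open>Behind the prefix \<open>ss\<close>, the reflections of \<open>ts\<close> appear
  conjugated by \<open>word_prod ss\<close>; conjugating \<open>r\<close> back instead gives the
  second term.\<close>

lemma inversion_parity_append:
  "ss \<in> lists S \<Longrightarrow> ts \<in> lists S \<Longrightarrow> r \<in> carrier W \<Longrightarrow>
    inversion_parity (ss @ ts) r =
      (inversion_parity ss r \<noteq>
       inversion_parity ts (inv (word_prod ss) \<otimes> r \<otimes> word_prod ss))"
proof (induction ss arbitrary: r)
  case (Cons s ss)
  then have "inv (word_prod ss) \<otimes> (s \<otimes> r \<otimes> s) \<otimes> word_prod ss =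
      inv (word_prod (s # ss)) \<otimes> r \<otimes> word_prod (s # ss)"
    by (simp add: inv_mult_group m_assoc)
  with Cons show ?case by auto
qed simp

text \<open>Conjugation by \<open>s\<close> inverts the rotation \<open>s \<otimes> t\<close>, so
  moving \<open>s\<close> across one power cancels it against the other.\<close>

lemma dihedral_conj:
  assumes "s \<in> S" "t \<in> S"
  shows "(s \<otimes> t) [^] (n::nat) \<otimes> s \<otimes> (s \<otimes> t) [^] n = s"
proof (induction n)
  case (Suc n)
  let ?a = "s \<otimes> t"
  have Suc2: "?a [^] Suc n = ?a \<otimes> ?a [^] n"
    using assms by (intro nat_pow_Suc2) simp
  have "?a [^] Suc n \<otimes> s \<otimes> ?a [^] Suc n = ?a [^] n \<otimes> ?a \<otimes> s \<otimes> (?a \<otimes> ?a [^] n)"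
    by (simp only: Suc2 [symmetric] nat_pow_Suc [symmetric])
  also have "\<dots> = ?a [^] n \<otimes> s \<otimes> ?a [^] n"
    using assms by (simp add: m_assoc)
  finally show ?case using Suc by simp
qed (use assms in simp)

lemma word_prod_dihedral:
  assumes "s \<in> S" "t \<in> S"
  shows "word_prod (concat (replicate n [s, t])) = (s \<otimes> t) [^] n"
proof (induction n)
  case (Suc n)
  have "(s \<otimes> t) [^] Suc n = (s \<otimes> t) \<otimes> (s \<otimes> t) [^] n"
    using assms by (intro nat_pow_Suc2) simp
  then show ?case using Suc assms by (simp add: m_assoc del: nat_pow_Suc)
qed simp

lemma concat_replicate_in_lists:
  "ss \<in> lists A \<Longrightarrow> concat (replicate n ss) \<in> lists A"
  by (induction n) auto

text \<open>The reflections attached to the alternating word \<open>stst...\<close> are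
  \<open>(st)^i s\<close>, with \<open>i\<close> counted from 0; the sum counts those equal to
  \<open>r\<close>.\<close>

lemma inversion_parity_dihedral:
  assumes "s \<in> S" "t \<in> S" "r \<in> carrier W"
  shows "inversion_parity (concat (replicate n [s, t])) r =
    odd (\<Sum>i<2*n. of_bool (r = (s \<otimes> t) [^] i \<otimes> s) :: nat)"
proof (induction n)
  case (Suc n)
  let ?a = "s \<otimes> t"
  let ?b = "?a [^] n"
  let ?r = "inv ?b \<otimes> r \<otimes> ?b"
  have a: "?a \<in> carrier W" and b: "?b \<in> carrier W" using assms by auto
  \<comment> \<open>This identity removes the inverses from all conjugates by \<open>?b\<close>
    below.\<close>
  have bs: "s \<otimes> inv ?b = ?b \<otimes> s"
    using dihedral_conj [OF assms(1,2), of n] assms by (simp add: inv_solve_right')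
  have pow: "?a [^] (2 * n) = ?b \<otimes> ?b"
    using a by (simp add: nat_pow_mult mult_2)
  have conj: "?r = x \<longleftrightarrow> r = ?b \<otimes> x \<otimes> inv ?b" if "x \<in> carrier W" for x
    using that assms(3) b by (auto simp: m_assoc)
  \<comment> \<open>The two letters appended in passing from \<open>n\<close> to
    \<open>Suc n\<close> have indices \<open>2 * n\<close> and \<open>Suc (2 * n)\<close>; facts
    \<open>1\<close> and \<open>2\<close> identify their reflections.\<close>
  have 1: "?r = s \<longleftrightarrow> r = ?a [^] (2 * n) \<otimes> s"
    using conj [of s] assms b by (simp add: pow m_assoc bs)
  have flip: "s \<otimes> z \<otimes> s = t \<longleftrightarrow> z = s \<otimes> t \<otimes> s" if "z \<in> carrier W" for z
    using that assms by (auto simp: m_assoc)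
  have "s \<otimes> ?r \<otimes> s = t \<longleftrightarrow> ?r = s \<otimes> t \<otimes> s"
    by (rule flip) (use assms b in simp)
  also have "\<dots> \<longleftrightarrow> r = ?b \<otimes> (?a \<otimes> s) \<otimes> inv ?b"
    using conj [of "?a \<otimes> s"] assms by simp
  also have "?b \<otimes> (?a \<otimes> s) \<otimes> inv ?b = ?b \<otimes> ?a \<otimes> (?b \<otimes> s)"
    using assms b by (simp add: m_assoc bs)
  also have "?b \<otimes> ?a \<otimes> (?b \<otimes> s) = ?b \<otimes> (?a \<otimes> ?b) \<otimes> s"
    using assms b by (simp add: m_assoc)
  also have "?a \<otimes> ?b = ?b \<otimes> ?a"
    using nat_pow_Suc2 [OF a, of n] by simp
  also have "?b \<otimes> (?b \<otimes> ?a) \<otimes> s = ?a [^] Suc (2 * n) \<otimes> s"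
    using assms b by (simp add: pow m_assoc)
  finally have 2: "s \<otimes> ?r \<otimes> s = t \<longleftrightarrow> r = ?a [^] Suc (2 * n) \<otimes> s" .
  have "concat (replicate (Suc n) [s, t]) = concat (replicate n [s, t]) @ [s, t]"
    by (simp flip: replicate_append_same)
  then have "inversion_parity (concat (replicate (Suc n) [s, t])) r =
      (inversion_parity (concat (replicate n [s, t])) r \<noteq> ((?r = s) \<noteq> (s \<otimes> ?r \<otimes> s = t)))"
    using assms
    by (simp add: inversion_parity_append concat_replicate_in_lists word_prod_dihedral)
  also have "\<dots> = odd (\<Sum>i<Suc (Suc (2 * n)). of_bool (r = ?a [^] i \<otimes> s) :: nat)"
    unfolding Suc 1 2 by (simp add: sum.lessThan_Suc del: nat_pow_Suc)
  finally show ?case by simp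
qed simp

lemma sum_lessThan_add:
  fixes f :: "nat \<Rightarrow> nat"
  shows "(\<Sum>i<k + n. f i) = (\<Sum>i<k. f i) + (\<Sum>i<n. f (k + i))"
  by (induction n) auto

text \<open>The sequence \<open>(st)\<^sup>i s\<close> has period \<open>n\<close>, so over \<open>2n\<close> indices every value is hit evenly often.\<close>

lemma inversion_parity_relator:
  assumes "s \<in> S" "t \<in> S" "r \<in> carrier W" "(s \<otimes> t) [^] (n::nat) = \<one>"
  shows "\<not> inversion_parity (concat (replicate n [s, t])) r"
proof -
  have "(s \<otimes> t) [^] (n + i) = (s \<otimes> t) [^] i" for i
    using assms by (simp flip: nat_pow_mult)
  then show ?thesis
    using assms by (simp add: inversion_parity_dihedral mult_2 sum_lessThan_add)
qed

text \<open>The word \<open>z\<close> contributes nothing itself, and as its value is trivial it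
  does not change the conjugation applied to the reflections of \<open>q\<close>.\<close>

lemma inversion_parity_insert:
  assumes "p \<in> lists S" "q \<in> lists S" "z \<in> lists S" "r \<in> carrier W" "word_prod z = \<one>"
    and "\<And>r. r \<in> carrier W \<Longrightarrow> \<not> inversion_parity z r"
  shows "inversion_parity (p @ z @ q) r = inversion_parity (p @ q) r"
  using assms by (simp add: inversion_parity_append)

text \<open>Words of equal value are linked by the moves of the presentation, and each move inserts
  or removes a word of value \<one> with zero parity everywhere. The map \<open>fst\<close> forgets
  formal inverses, which is harmless for involutions.\<close>

lemma inversion_parity_cong:
  assumes "v \<in> lists S" "w \<in> lists S" "word_prod v = word_prod w" "r \<in> carrier W"
  shows "inversion_parity v r = inversion_parity w r"
proof -
  obtain m where "has_presentation W S (coxeter_relators S m)"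
    using coxeter by (auto simp: coxeter_system_def)
  then have R: "coxeter_relators S m \<subseteq> lists (S \<times> UNIV)"
    and pres: "\<And>v w. v \<in> lists (S \<times> UNIV) \<Longrightarrow> w \<in> lists (S \<times> UNIV) \<Longrightarrow>
      eval_word W v = eval_word W w \<longleftrightarrow> presented_eq S (coxeter_relators S m) v w"
    unfolding has_presentation_def by blast+
  have inv: "inversion_parity (map fst v) r = inversion_parity (map fst w) r"
    if "presented_eq S (coxeter_relators S m) v w" for v w
    using that
  proof (induction rule: presented_eq.induct)
    case (cancel p q s b)
    have "map fst p \<in> lists S" "map fst q \<in> lists S" using cancel by fastforce+
    \<comment> \<open>The word \<open>ss\<close> is the dihedral word with \<open>t = s\<close> and
      \<open>n = 1\<close>.\<close>
    moreover have "\<not> inversion_parity [s, s] z" if "z \<in> carrier W" for z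
      using inversion_parity_relator [of s s z 1] cancel that
      by (simp del: inversion_parity.simps)
    ultimately have "inversion_parity (map fst p @ [s, s] @ map fst q) r =
        inversion_parity (map fst p @ map fst q) r"
      using cancel assms by (intro inversion_parity_insert) (simp_all del: inversion_parity.simps)
    then show ?case by simp
  next
    case (relator p q z)
    then have z: "z \<in> lists (S \<times> UNIV)" using R by blast
    have pqz: "map fst p \<in> lists S" "map fst q \<in> lists S" "map fst z \<in> lists S"
      using relator z by fastforce+
    obtain s t n where st: "s \<in> S" "t \<in> S" "z = concat (replicate n [(s, True), (t, True)])"
      using relator by (auto simp: coxeter_relators_def)
    have z_eq: "map fst z = concat (replicate n [s, t])"
      by (simp add: st(3) map_concat)
    have "presented_eq S (coxeter_relators S m) ([] @ z @ []) ([] @ [])"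
      using relator by (intro presented_eq.relator) auto
    then have "eval_word W z = eval_word W []" using pres [of z "[]"] z by simp
    then have one: "word_prod (map fst z) = \<one>" using z by (simp add: eval_word_eq_word_prod)
    then have "(s \<otimes> t) [^] n = \<one>" by (metis st(1,2) z_eq word_prod_dihedral)
    then have "\<not> inversion_parity (map fst z) x" if "x \<in> carrier W" for x
      unfolding z_eq using inversion_parity_relator st that by blast
    then have "inversion_parity (map fst p @ map fst z @ map fst q) r =
        inversion_parity (map fst p @ map fst q) r"
      using pqz assms(4) one by (intro inversion_parity_insert)
    then show ?case by simp
  qed auto
  \<comment> \<open>Words in \<open>S\<close> enter the presentation as words without formal
    inverses.\<close>
  let ?l = "map (\<lambda>s. (s, True))"
  have l: "?l v \<in> lists (S \<times> UNIV)" "?l w \<in> lists (S \<times> UNIV)" using assms by auto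
  then have "presented_eq S (coxeter_relators S m) (?l v) (?l w)"
    using pres [OF l] assms(3) by (simp only: eval_word_eq_word_prod map_map o_def fst_conv map_ident simp_thms)
  from inv [OF this] show ?thesis by (simp add: o_def)
qed

section \<open>Deletion and exchange\<close>

text \<open>An odd count is nonzero, so \<open>r\<close> is the reflection attached to some letter,
  and left multiplication by that reflection deletes the letter.\<close>

lemma inversion_parity_imp_deletion:
  "w \<in> lists S \<Longrightarrow> r \<in> carrier W \<Longrightarrow> inversion_parity w r \<Longrightarrow>
    \<exists>p s q. w = p @ s # q \<and> r \<otimes> word_prod w = word_prod (p @ q)"
proof (induction w arbitrary: r)
  case (Cons s w)
  then have s: "s \<in> S" and w: "w \<in> lists S" by auto
  show ?case
  proof (cases "r = s")
    case True
    have "s # w = [] @ s # w \<and> r \<otimes> word_prod (s # w) = word_prod ([] @ w)"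
      using True s w by simp
    then show ?thesis by blast
  next
    case False
    then have "inversion_parity w (s \<otimes> r \<otimes> s)" using Cons.prems by simp
    with Cons.IH [of "s \<otimes> r \<otimes> s"] s w Cons.prems
    obtain p s' q where pq: "w = p @ s' # q" "s \<otimes> r \<otimes> s \<otimes> word_prod w = word_prod (p @ q)"
      by auto
    have "r \<otimes> word_prod (s # w) = s \<otimes> (s \<otimes> r \<otimes> s \<otimes> word_prod w)"
      using s w Cons.prems by (simp add: m_assoc)
    also have "\<dots> = word_prod ((s # p) @ q)"
      using pq(2) by simp
    finally have "s # w = (s # p) @ s' # q \<and> r \<otimes> word_prod (s # w) = word_prod ((s # p) @ q)"
      using pq(1) by simp
    then show ?thesis by blast
  qed
qed simp

text \<open>Putting \<open>s\<close> before a reduced word of \<open>s \<otimes> word_prod w\<close>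
  gives a word with the value of \<open>w\<close> in which the reflection \<open>s\<close> has odd
  parity. Parity depends only on the value, so it is odd for \<open>w\<close> too, and deletion
  applies.\<close>

lemma exchange:
  assumes "w \<in> lists S" "s \<in> Des (word_prod w)"
  shows "\<exists>p t q. w = p @ t # q \<and> s \<otimes> word_prod w = word_prod (p @ q)"
proof -
  let ?x = "word_prod w"
  have s: "s \<in> S" and less: "len (s \<otimes> ?x) < len ?x"
    using assms(2) by (auto simp: left_descents_def)
  have x: "?x \<in> carrier W" using assms by simp
  obtain ss where ss: "ss \<in> lists S" "length ss = len (s \<otimes> ?x)" "word_prod ss = s \<otimes> ?x"
    using ex_reduced_word [of "s \<otimes> ?x"] s x by auto
  \<comment> \<open>Otherwise a deletion in \<open>ss\<close> would spell \<open>?x\<close> with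
    fewer than \<open>len (s \<otimes> ?x)\<close> letters, although \<open>?x\<close> is the longer
    element.\<close>
  have "\<not> inversion_parity ss s"
  proof
    assume "inversion_parity ss s"
    then obtain p t q where pq: "ss = p @ t # q" "s \<otimes> word_prod ss = word_prod (p @ q)"
      using inversion_parity_imp_deletion ss(1) s S_closed by blast
    have "len (word_prod (p @ q)) \<le> length (p @ q)"
      using ss(1) pq(1) by (intro len_word_prod_le) auto
    moreover have "word_prod (p @ q) = ?x"
      using pq(2) s x by (simp add: ss(3))
    ultimately show False using less ss(2) pq(1) by simp
  qed
  \<comment> \<open>The leading letter counts once, and the tail is tested at
    \<open>s \<otimes> s \<otimes> s\<close>, which is \<open>s\<close> again.\<close>
  then have "inversion_parity (s # ss) s" using s by (simp add: m_assoc)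
  moreover have "inversion_parity (s # ss) s = inversion_parity w s"
    using s ss assms(1) by (intro inversion_parity_cong) auto
  ultimately show ?thesis
    using inversion_parity_imp_deletion assms(1) s by simp
qed

text \<open>Exchange \<open>s\<close> into a shortest word of \<open>y\<close> beginning with
  \<open>t\<close>. Deleting the leading \<open>t\<close> would force \<open>s = t\<close>; deleting
  a later letter leaves a word of \<open>s \<otimes> y\<close> that still begins with
  \<open>t\<close>.\<close>

lemma descent_of_descent:
  assumes "y \<in> carrier W" "s \<in> Des y" "t \<in> Des y" "s \<noteq> t"
  shows "t \<in> Des (s \<otimes> y)"
proof -
  have s: "s \<in> S" and t: "t \<in> S" and ty: "len (t \<otimes> y) < len y"
    using assms by (auto simp: left_descents_def)
  obtain ss where ss: "ss \<in> lists S" "length ss = len (t \<otimes> y)" "word_prod ss = t \<otimes> y"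
    using ex_reduced_word [of "t \<otimes> y"] t assms(1) by auto
  have y: "word_prod (t # ss) = y" using ss t assms(1) by simp
  then obtain p r q where pq: "t # ss = p @ r # q" "s \<otimes> y = word_prod (p @ q)"
    using exchange [of "t # ss" s] ss(1) t assms(2) by auto
  show ?thesis
  proof (cases p)
    case Nil
    then have "s \<otimes> y = t \<otimes> y" using pq ss by simp
    then show ?thesis using assms s t by simp
  next
    case (Cons t' p')
    then have ss_eq: "ss = p' @ r # q" and sy: "s \<otimes> y = t \<otimes> word_prod (p' @ q)"
      using pq by auto
    have pq': "p' @ q \<in> lists S" using ss(1) ss_eq by auto
    have "t \<otimes> (s \<otimes> y) = word_prod (p' @ q)"
      using sy t pq' by simp
    then have "len (t \<otimes> (s \<otimes> y)) \<le> length (p' @ q)"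
      using len_word_prod_le [OF pq'] by simp
    moreover have "len y \<le> 1 + len (s \<otimes> y)"
      using len_mult_le [of s "s \<otimes> y"] len_generator_le [OF s] s assms(1) by simp
    ultimately show ?thesis using t ty ss ss_eq by (simp add: left_descents_def)
  qed
qed

section \<open>The left weak order\<close>

lemma weak_le_refl: "x \<in> carrier W \<Longrightarrow> x \<le>\<^sub>L x"
  by (simp add: left_weak_le_def)

lemma weak_le_antisym:
  assumes "x \<in> carrier W" "y \<in> carrier W" "x \<le>\<^sub>L y" "y \<le>\<^sub>L x"
  shows "x = y"
proof -
  have "len (y \<otimes> inv x) = 0" using assms(3,4) by (simp add: left_weak_le_def)
  then have "y \<otimes> inv x = \<one>" using assms by (simp add: len_eq_0_iff)
  then show ?thesis using assms by (metis inv_equality inv_closed inv_inv)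
qed

text \<open>\<open>x \<le>\<^sub>L y\<close> is the equality case of this bound, so proving it only
  ever requires the reverse inequality.\<close>

lemma len_le_add_quotient:
  assumes "x \<in> carrier W" "y \<in> carrier W"
  shows "len y \<le> len x + len (y \<otimes> inv x)"
  using len_mult_le [of "y \<otimes> inv x" x] assms by (simp add: m_assoc)

text \<open>The triangle inequality for the distance \<open>len (y \<otimes> inv x)\<close>.\<close>

lemma len_quotient_le:
  assumes "x \<in> carrier W" "y \<in> carrier W" "z \<in> carrier W"
  shows "len (z \<otimes> inv x) \<le> len (y \<otimes> inv x) + len (z \<otimes> inv y)"
proof -
  have "z \<otimes> inv y \<otimes> (y \<otimes> inv x) = z \<otimes> inv x"
    using assms by (simp add: m_assoc)
  then show ?thesis using len_mult_le [of "z \<otimes> inv y" "y \<otimes> inv x"] assms by simp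
qed

lemma weak_le_trans:
  assumes "x \<in> carrier W" "y \<in> carrier W" "z \<in> carrier W" "x \<le>\<^sub>L y" "y \<le>\<^sub>L z"
  shows "x \<le>\<^sub>L z"
  using assms len_quotient_le [of x y z] len_le_add_quotient [of x z]
  by (simp add: left_weak_le_def)

section \<open>Intervals as right translates\<close>

lemma ival_closed: "x \<in> ival u v \<Longrightarrow> x \<in> carrier W"
  by (simp add: left_weak_interval_def)

lemma quotient_translate:
  assumes "x \<in> carrier W" "y \<in> carrier W" "u \<in> carrier W"
  shows "(y \<otimes> u) \<otimes> inv (x \<otimes> u) = y \<otimes> inv x"
  using assms by (simp add: inv_mult_group m_assoc)

text \<open>Above \<open>u\<close>, translation by \<open>u\<close> adds \<open>len u\<close> to
  both lengths and leaves the quotient unchanged.\<close>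

lemma weak_le_translate:
  assumes "x \<in> carrier W" "y \<in> carrier W" "u \<in> carrier W" "u \<le>\<^sub>L x \<otimes> u" "u \<le>\<^sub>L y \<otimes> u"
  shows "x \<otimes> u \<le>\<^sub>L y \<otimes> u \<longleftrightarrow> x \<le>\<^sub>L y"
proof -
  have "len (x \<otimes> u) = len u + len x" "len (y \<otimes> u) = len u + len y"
    using assms by (auto simp: left_weak_le_def m_assoc)
  then show ?thesis using assms by (simp add: left_weak_le_def quotient_translate)
qed

text \<open>Identifies \<open>ival u v\<close> with the elements below
  \<open>v \<otimes> inv u\<close>. In one direction the two length equations add up; in the other,
  \<open>len v\<close> equals the sum of the upper bounds, so each bound is attained.\<close>

lemma translate_mem_ival_iff:
  assumes "z \<in> carrier W" "u \<in> carrier W" "v \<in> carrier W" "u \<le>\<^sub>L v"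
  shows "z \<otimes> u \<in> ival u v \<longleftrightarrow> z \<le>\<^sub>L v \<otimes> inv u"
proof -
  let ?w = "v \<otimes> inv u"
  have w: "?w \<in> carrier W" and v: "?w \<otimes> u = v" using assms by (auto simp: m_assoc)
  have *: "v \<otimes> inv (z \<otimes> u) = ?w \<otimes> inv z"
    using quotient_translate [of z ?w u] assms w v by simp
  have zu: "z \<otimes> u \<otimes> inv u = z" using assms by (simp add: m_assoc)
  have "len v = len u + len ?w" using assms by (simp add: left_weak_le_def)
  moreover have "len v \<le> len (z \<otimes> u) + len (?w \<otimes> inv z)"
    using len_le_add_quotient [of "z \<otimes> u" v] assms * by simp
  moreover have "len (z \<otimes> u) \<le> len u + len z" using len_mult_le [of z u] assms by simp
  ultimately show ?thesis
    using assms by (auto simp: left_weak_interval_def left_weak_le_def * zu)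
qed

lemma descent_preserving_iso_translate:
  assumes "u \<in> carrier W" "v \<in> carrier W" "u \<le>\<^sub>L v"
    and "u' \<in> carrier W" "v' \<in> carrier W" "u' \<le>\<^sub>L v'"
    and w: "v \<otimes> inv u = v' \<otimes> inv u'"
    and des: "\<forall>x\<in>ival u v. Des x = Des (x \<otimes> inv u \<otimes> u')"
  shows "descent_preserving_iso W S (ival u v) (ival u' v') (\<lambda>x. x \<otimes> inv u \<otimes> u')"
proof -
  \<comment> \<open>General endpoints let this serve both the translation and its inverse.\<close>
  have fwd: "x \<otimes> inv a \<otimes> b \<in> ival b d"
    if "x \<in> ival a c" "a \<in> carrier W" "c \<in> carrier W" "a \<le>\<^sub>L c"
      "b \<in> carrier W" "d \<in> carrier W" "b \<le>\<^sub>L d" "c \<otimes> inv a = d \<otimes> inv b" for a b c d x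
  proof -
    have x: "x \<in> carrier W" using that(1) by (rule ival_closed)
    have "x \<otimes> inv a \<otimes> a \<in> ival a c" using that x by (simp add: m_assoc)
    then show ?thesis using that x translate_mem_ival_iff by simp
  qed
  have cancel: "x \<otimes> inv a \<otimes> b \<otimes> inv b \<otimes> a = x"
    if "x \<in> carrier W" "a \<in> carrier W" "b \<in> carrier W" for a b x
    using that by (simp add: m_assoc)
  have "bij_betw (\<lambda>x. x \<otimes> inv u \<otimes> u') (ival u v) (ival u' v')"
    by (rule bij_betw_byWitness [where f' = "\<lambda>x. x \<otimes> inv u' \<otimes> u"])
      (use assms fwd cancel ival_closed in auto)
  moreover have "x \<le>\<^sub>L y \<longleftrightarrow> x \<otimes> inv u \<otimes> u' \<le>\<^sub>L y \<otimes> inv u \<otimes> u'"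
    if "x \<in> ival u v" "y \<in> ival u v" for x y
  proof -
    have xy: "x \<in> carrier W" "y \<in> carrier W" using that by (auto dest: ival_closed)
    have "u \<le>\<^sub>L x" "u \<le>\<^sub>L y" using that by (auto simp: left_weak_interval_def)
    then have "x \<le>\<^sub>L y \<longleftrightarrow> x \<otimes> inv u \<le>\<^sub>L y \<otimes> inv u"
      using weak_le_translate [of "x \<otimes> inv u" "y \<otimes> inv u" u] xy assms by (simp add: m_assoc)
    moreover have "x \<otimes> inv u \<otimes> u' \<in> ival u' v'" "y \<otimes> inv u \<otimes> u' \<in> ival u' v'"
      using that assms by (auto intro: fwd)
    then have "u' \<le>\<^sub>L x \<otimes> inv u \<otimes> u'" "u' \<le>\<^sub>L y \<otimes> inv u \<otimes> u'"
      by (auto simp: left_weak_interval_def)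
    ultimately show ?thesis
      using weak_le_translate [of "x \<otimes> inv u" "y \<otimes> inv u" u'] xy assms by simp
  qed
  ultimately show ?thesis using des unfolding descent_preserving_iso_def by blast
qed

section \<open>Covers in the left weak order\<close>

text \<open>The letter \<open>s\<close> is the last one of a reduced word of
  \<open>y \<otimes> inv x\<close>, since that letter acts on \<open>x\<close> first.\<close>

lemma weak_le_first_step:
  assumes "x \<in> carrier W" "y \<in> carrier W" "x \<le>\<^sub>L y" "x \<noteq> y"
  obtains s where "s \<in> S" "len (s \<otimes> x) = Suc (len x)" "s \<otimes> x \<le>\<^sub>L y"
proof -
  let ?g = "y \<otimes> inv x"
  have g: "?g \<in> carrier W" and gx: "?g \<otimes> x = y" using assms by (auto simp: m_assoc)
  obtain ss where ss: "ss \<in> lists S" "length ss = len ?g" "word_prod ss = ?g"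
    using ex_reduced_word g .
  have "ss \<noteq> []" using ss(3) gx assms(2,4) by (metis l_one assms(1) word_prod_Nil)
  then obtain ts s where ts: "ss = ts @ [s]" by (metis rev_exhaust)
  then have s: "s \<in> S" and tsS: "ts \<in> lists S" using ss(1) by auto
  have "?g = word_prod ts \<otimes> s" using ss ts s tsS by (simp add: word_prod_append)
  then have "y \<otimes> inv (s \<otimes> x) = word_prod ts"
    using s assms tsS by (simp add: inv_mult_group m_assoc [symmetric]) (simp add: m_assoc)
  then have "len (y \<otimes> inv (s \<otimes> x)) \<le> length ts" using len_word_prod_le [OF tsS] by simp
  moreover have "len (s \<otimes> x) \<le> 1 + len x"
    using len_mult_le [of s x] len_generator_le [OF s] s assms by simp
  \<comment> \<open>The two upper bounds above add up to \<open>len y\<close>, so this inequality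
    turns both into equalities.\<close>
  moreover have "len y \<le> len (s \<otimes> x) + len (y \<otimes> inv (s \<otimes> x))"
    using len_le_add_quotient s assms by simp
  moreover have "len y = len x + Suc (length ts)"
    using assms ss(2) ts by (simp add: left_weak_le_def)
  ultimately show ?thesis
    using that [OF s] by (simp add: left_weak_le_def)
qed

text \<open>Here \<open>s\<close> is the first letter of a reduced word of
  \<open>y \<otimes> inv x\<close>; multiplying \<open>y\<close> by \<open>s\<close> strips it
  off.\<close>

lemma weak_le_last_step:
  assumes "x \<in> carrier W" "y \<in> carrier W" "x \<le>\<^sub>L y" "x \<noteq> y"
  obtains s where "s \<in> S" "len y = Suc (len (s \<otimes> y))" "x \<le>\<^sub>L s \<otimes> y" "s \<otimes> y \<le>\<^sub>L y"
proof -
  let ?g = "y \<otimes> inv x"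
  have g: "?g \<in> carrier W" and gx: "?g \<otimes> x = y" using assms by (auto simp: m_assoc)
  obtain ss where ss: "ss \<in> lists S" "length ss = len ?g" "word_prod ss = ?g"
    using ex_reduced_word g .
  have "ss \<noteq> []" using ss(3) gx assms(2,4) by (metis l_one assms(1) word_prod_Nil)
  then obtain s ts where ts: "ss = s # ts" by (cases ss) auto
  then have s: "s \<in> S" and tsS: "ts \<in> lists S" using ss(1) by auto
  have "s \<otimes> ?g = word_prod ts" using ss(3) ts s tsS by (simp flip: ss(3))
  then have sg: "s \<otimes> y \<otimes> inv x = word_prod ts" using s assms by (simp add: m_assoc)
  then have "len (s \<otimes> y \<otimes> inv x) \<le> length ts" using len_word_prod_le [OF tsS] by simp
  moreover have "len (s \<otimes> y) \<le> len x + len (s \<otimes> y \<otimes> inv x)"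
    using len_le_add_quotient s assms by simp
  moreover have ys: "y \<otimes> inv (s \<otimes> y) = s"
    using s assms by (simp add: inv_mult_group m_assoc [symmetric])
  moreover have "len y \<le> len (s \<otimes> y) + len s"
    using len_le_add_quotient [of "s \<otimes> y" y] s assms ys by simp
  moreover have "len y = len x + Suc (length ts)"
    using assms ss(2) ts by (simp add: left_weak_le_def)
  moreover have "len s \<le> 1" using len_generator_le s .
  ultimately show ?thesis
    using that [OF s] by (simp add: left_weak_le_def)
qed

text \<open>The lengths of \<open>a \<otimes> inv x\<close> and \<open>y \<otimes> inv a\<close> add
  up to 1, so one of them is 0.\<close>

lemma weak_le_cover:
  assumes "x \<in> carrier W" "a \<in> carrier W" "y \<in> carrier W"
    and "x \<le>\<^sub>L a" "a \<le>\<^sub>L y" "len y = Suc (len x)"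
  shows "a = x \<or> a = y"
proof -
  have eq: "b = c" if "b \<in> carrier W" "c \<in> carrier W" "len (c \<otimes> inv b) = 0" for b c
    using that by (metis inv_closed len_eq_0_iff m_closed inv_equality inv_inv)
  have "len (a \<otimes> inv x) = 0 \<or> len (y \<otimes> inv a) = 0"
    using assms by (auto simp: left_weak_le_def)
  then show ?thesis using eq assms by metis
qed

section \<open>Rigidity of descent-preserving isomorphisms\<close>

text \<open>Induction on length: strip a letter \<open>s\<close> off \<open>x\<close>, use the
  formula at \<open>s \<otimes> x\<close>, and show that \<open>f\<close> maps this cover to a cover
  with the same label.\<close>

lemma descent_preserving_iso_eq_translate:
  assumes u: "u \<in> carrier W" "v \<in> carrier W" "u \<le>\<^sub>L v"
    and u': "u' \<in> carrier W" "v' \<in> carrier W" "u' \<le>\<^sub>L v'"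
    and iso: "descent_preserving_iso W S (ival u v) (ival u' v') f"
  shows "x \<in> ival u v \<Longrightarrow> f x = x \<otimes> inv u \<otimes> u'"
proof (induction "len x" arbitrary: x rule: less_induct)
  case less
  have bij: "bij_betw f (ival u v) (ival u' v')"
    and mono: "\<And>x y. x \<in> ival u v \<Longrightarrow> y \<in> ival u v \<Longrightarrow> x \<le>\<^sub>L y \<longleftrightarrow> f x \<le>\<^sub>L f y"
    and des: "\<And>x. x \<in> ival u v \<Longrightarrow> Des x = Des (f x)"
    using iso by (auto simp: descent_preserving_iso_def)
  have f_mem: "\<And>x. x \<in> ival u v \<Longrightarrow> f x \<in> ival u' v'"
    using bij by (auto simp: bij_betw_def)
  have x: "x \<in> carrier W" "u \<le>\<^sub>L x" "x \<le>\<^sub>L v"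
    using less by (auto simp: left_weak_interval_def)
  show ?case
  proof (cases "x = u")
    case True
    \<comment> \<open>The preimage of \<open>u'\<close> lies above \<open>u\<close>, so
      \<open>f u\<close> lies below the least element \<open>u'\<close>.\<close>
    have "u' \<in> ival u' v'" using u' weak_le_refl by (simp add: left_weak_interval_def)
    then obtain a where a: "a \<in> ival u v" "f a = u'"
      using bij by (metis bij_betw_def imageE)
    then have "f u \<le>\<^sub>L u'"
      using mono [of u a] less True by (auto simp: left_weak_interval_def)
    moreover have "u' \<le>\<^sub>L f u" "f u \<in> carrier W"
      using f_mem less True by (auto simp: left_weak_interval_def)
    ultimately have "f u = u'" using weak_le_antisym u' by blast
    then show ?thesis using True u u' by simp
  next
    case False
    then obtain s where s: "s \<in> S" "len x = Suc (len (s \<otimes> x))" "u \<le>\<^sub>L s \<otimes> x" "s \<otimes> x \<le>\<^sub>L x"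
      using weak_le_last_step [of u x] u x by metis
    let ?x = "s \<otimes> x"
    have x': "?x \<in> ival u v"
      using s x u weak_le_trans [of ?x x v] by (simp add: left_weak_interval_def)
    have fx': "f ?x = ?x \<otimes> inv u \<otimes> u'" using less(1) x' s by simp
    have fc: "f x \<in> carrier W" "f ?x \<in> carrier W"
      using f_mem less(2) x' by (auto dest: ival_closed)
    have ne: "f ?x \<noteq> f x"
      using bij x' less(2) s(2) by (auto simp: bij_betw_def inj_on_def)
    have "f ?x \<le>\<^sub>L f x" using mono x' less(2) s(4) by blast
    then obtain t where t: "t \<in> S" "len (t \<otimes> f ?x) = Suc (len (f ?x))" "t \<otimes> f ?x \<le>\<^sub>L f x"
      using weak_le_first_step fc ne by metis
    let ?y = "t \<otimes> f ?x"
    have yc: "?y \<in> carrier W" using t fc by simp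
    have "?y \<otimes> inv (f ?x) = t" using t fc by (simp add: m_assoc)
    then have le: "f ?x \<le>\<^sub>L ?y"
      using t len_generator_le [OF t(1)] len_le_add_quotient [of "f ?x" ?y] fc yc
      by (simp add: left_weak_le_def)
    have "?y \<in> ival u' v'"
      using f_mem [OF x'] f_mem [OF less(2)] weak_le_trans [of u' "f ?x" ?y]
        weak_le_trans [of ?y "f x" v'] u' le t yc
      by (simp add: left_weak_interval_def)
    \<comment> \<open>Pulling \<open>?y\<close> back along \<open>f\<close> gives an element between
      \<open>?x\<close> and \<open>x\<close>; as these are one step apart, \<open>?y\<close> must be
      \<open>f x\<close>.\<close>
    then obtain a where a: "a \<in> ival u v" "f a = ?y"
      using bij by (metis bij_betw_def imageE)
    have "?x \<le>\<^sub>L a" "a \<le>\<^sub>L x" using mono a x' less(2) le t by auto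
    then have "a = ?x \<or> a = x"
      using weak_le_cover [of ?x a x] a s x by (auto dest: ival_closed)
    moreover have "a \<noteq> ?x" using a t by auto
    ultimately have fx: "f x = t \<otimes> f ?x" using a by simp
    have "s = t"
    \<comment> \<open>If the labels differed, the descent \<open>s\<close> of \<open>f x\<close>
      would survive the removal of \<open>t\<close> and be a descent of \<open>f ?x\<close>, hence
      of \<open>?x\<close>; but \<open>s\<close> lengthens \<open>?x\<close>.\<close>
    proof (rule ccontr)
      assume "s \<noteq> t"
      have "s \<in> Des (f x)" using des [OF less(2)] s by (auto simp: left_descents_def)
      moreover have "t \<otimes> f x = f ?x" using fx t fc by simp
      moreover have "t \<in> Des (f x)" using fx t fc by (simp add: left_descents_def)
      ultimately have "s \<in> Des (f ?x)"
        using descent_of_descent [of "f x" t s] fc \<open>s \<noteq> t\<close> by simp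
      then have "s \<in> Des ?x" using des [OF x'] by simp
      then show False using s x by (simp add: left_descents_def)
    qed
    then have "f x = s \<otimes> (s \<otimes> x \<otimes> inv u \<otimes> u')" using fx fx' by simp
    also have "\<dots> = x \<otimes> inv u \<otimes> u'" using s x u u' by (simp add: m_assoc)
    finally show ?thesis .
  qed
qed

lemma descent_preserving_isomorphic_iff:
  assumes u: "u \<in> carrier W" "v \<in> carrier W" "u \<le>\<^sub>L v"
    and u': "u' \<in> carrier W" "v' \<in> carrier W" "u' \<le>\<^sub>L v'"
  shows "descent_preserving_isomorphic W S (ival u v) (ival u' v') \<longleftrightarrow>
    v \<otimes> inv u = v' \<otimes> inv u' \<and> (\<forall>x\<in>ival u v. Des x = Des (x \<otimes> inv u \<otimes> u'))"
    (is "?L \<longleftrightarrow> ?R")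
proof
  assume ?L
  then obtain f where f: "descent_preserving_iso W S (ival u v) (ival u' v') f"
    by (auto simp: descent_preserving_isomorphic_def)
  have eq: "f x = x \<otimes> inv u \<otimes> u'" if "x \<in> ival u v" for x
    using descent_preserving_iso_eq_translate [OF u u' f that] .
  have v: "v \<in> ival u v" and v': "v' \<in> ival u' v'"
    using u u' weak_le_refl by (auto simp: left_weak_interval_def)
  \<comment> \<open>The preimage of \<open>v'\<close> lies below \<open>v\<close>, so
    \<open>f\<close> sends top to top; the translation formula at \<open>v\<close> then equates the
    quotients.\<close>
  from v' f obtain a where a: "a \<in> ival u v" "f a = v'"
    unfolding descent_preserving_iso_def by (metis bij_betw_def imageE)
  then have "a \<le>\<^sub>L v" by (simp add: left_weak_interval_def)
  then have "v' \<le>\<^sub>L f v"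
    using f v a unfolding descent_preserving_iso_def by blast
  moreover have "f v \<in> ival u' v'"
    using f v unfolding descent_preserving_iso_def by (blast dest: bij_betwE)
  then have "f v \<le>\<^sub>L v'" "f v \<in> carrier W" by (auto simp: left_weak_interval_def)
  ultimately have "v' = v \<otimes> inv u \<otimes> u'"
    using weak_le_antisym [of v' "f v"] u' eq [OF v] by simp
  then have "v \<otimes> inv u = v' \<otimes> inv u'" using u u' by (simp add: m_assoc)
  moreover have "\<forall>x\<in>ival u v. Des x = Des (x \<otimes> inv u \<otimes> u')"
    using f eq by (simp add: descent_preserving_iso_def)
  ultimately show ?R ..
next
  assume ?R
  then show ?L
    using descent_preserving_iso_translate [OF u u']
    unfolding descent_preserving_isomorphic_def by blast
qed

end

theorem theorem3p6:
  fixes W :: "('a, 'b) monoid_scheme" and S :: "'a set" and u v u' v' :: 'a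
  assumes "coxeter_system W S"
    and "u \<in> carrier W" and "v \<in> carrier W" and "left_weak_le W S u v"
    and "u' \<in> carrier W" and "v' \<in> carrier W" and "left_weak_le W S u' v'"
  shows "descent_preserving_isomorphic W S
            (left_weak_interval W S u v) (left_weak_interval W S u' v')
    \<longleftrightarrow>
      v \<otimes>\<^bsub>W\<^esub> inv\<^bsub>W\<^esub> u = v' \<otimes>\<^bsub>W\<^esub> inv\<^bsub>W\<^esub> u' \<and>
      (\<forall>x \<in> left_weak_interval W S u v.
        left_descents W S x = left_descents W S (x \<otimes>\<^bsub>W\<^esub> inv\<^bsub>W\<^esub> u \<otimes>\<^bsub>W\<^esub> u'))"
proof -
  interpret coxeter_group W S
    using assms(1) by (simp add: coxeter_group_def coxeter_group_axioms_def coxeter_system_def)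
  show ?thesis
    using assms(2-7) by (rule descent_preserving_isomorphic_iff)
qed

end
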